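(* Consider the explicit fully discrete scheme O2EXP-MultiD for the two-fluid relativistic plasma flow equations: given admissible cell values $\mathbf{U}^n_{i,j}$ and a time step $\Delta t>0$, set $\mathbf{U}^{(0)}=\mathbf{U}^n$ and, for $0\le i<N_x$, $0\le j<N_y$, $$\mathbf{U}^{(1)}_{i,j}=\mathbf{U}^{(0)}_{i,j}+\Delta t\,\mathcal{L}_{i,j}(\mathbf{U}^{(0)})+\Delta t\,\mathcal{S}(\mathbf{U}^{(0)}_{i,j}),\qquad \mathbf{U}^{(2)}_{i,j}=\mathbf{U}^{(1)}_{i,j}+\Delta t\,\mathcal{L}_{i,j}(\mathbf{U}^{(1)})+\Delta t\,\mathcal{S}(\mathbf{U}^{(1)}_{i,j}),$$ $$\mathbf{U}^{n+1}_{i,j}=\tfrac12\big(\mathbf{U}^{(0)}_{i,j}+\mathbf{U}^{(2)}_{i,j}\big),$$ where $$\mathcal{L}_{i,j}(\mathbf{U})=-\frac1{\Delta x}\left(\mathbf{F}^x_{i+\frac12,j}-\mathbf{F}^x_{i-\frac12,j}\right)-\frac1{\Delta y}\left(\mathbf{F}^y_{i,j+\frac12}-\mathbf{F}^y_{i,j-\frac12}\right)$$ with the numerical fluxes and source defined in the context, and where $\mathbf{U}^{(1)}$ is also assumed to have admissible values. Then, for every vertex with $0\le i\le N_x-2$, $0\le j\le N_y-2$, the magnetic field satisfies $$\left(\nabla \cdot \mathbf{B}^{n+1}\right)_{i+\frac12,j+\frac12} = \left(\nabla \cdot \mathbf{B}^n\right)_{i+\frac12,j+\frac12}$$ and the electric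 field satisfies $$\left(\nabla \cdot \mathbf{E}^{n+1}\right)_{i+\frac12,j+\frac12} = \left(\nabla \cdot \mathbf{E}^n\right)_{i+\frac12,j+\frac12} -\frac{\Delta t}{2} \left( \left(\nabla \cdot \mathbf{J}^{n}\right)_{i+\frac12,j+\frac12} + \left(\nabla \cdot \mathbf{J}^{(1)}\right)_{i+\frac12,j+\frac12}\right),$$ where $\mathbf{J}^n$ and $\mathbf{J}^{(1)}$ are the current densities evaluated cellwise at $\mathbf{U}^n$ and $\mathbf{U}^{(1)}$ (these are consistent with the continuous identities $\partial_t(\nabla\cdot\mathbf{B})=0$ and $\partial_t(\nabla\cdot\mathbf{E})=-\nabla\cdot\mathbf{J}$).
   Context: **Unknowns.** Two fluid species $\alpha\in\{i,e\}$ (ions, electrons) with primitive variables: density $\rho_\alpha>0$, pressure $p_\alpha>0$, velocity $\mathbf{u}_\alpha=(u^x_\alpha,u^y_\alpha,u^z_\alpha)$, $|\mathbf{u}_\alpha|<1$. Constants: $\gamma_\alpha\in(1,2]$ and charge-to-mass ratios $r_\alpha\in\mathbb{R}$. Put $\Gamma_\alpha=(1-|\mathbf{u}_\alpha|^2)^{-1/2}$, $h_\alpha=1+\frac{\gamma_\alpha}{\gamma_\alpha-1}\frac{p_\alpha}{\rho_\alpha}$, $D_\alpha=\rho_\alpha\Gamma_\alpha$, $\mathbf{m}_\alpha=(m_\alpha^x,m_\alpha^y,m_\alpha^z)=\rho_\alpha h_\alpha\Gamma_\alpha^2\mathbf{u}_\alpha$, $\mathcal{E}_\alpha=\rho_\alpha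 h_\alpha\Gamma_\alpha^2-p_\alpha$ (total energy density). The conservative vector is $\mathbf{U}=(\mathbf{U}_i,\mathbf{U}_e,\mathbf{U}_m)\in\mathbb{R}^{16}$, $\mathbf{U}_\alpha=(D_\alpha,\mathbf{m}_\alpha,\mathcal{E}_\alpha)$, $\mathbf{U}_m=(\mathbf{B},\mathbf{E})=(B_x,B_y,B_z,E_x,E_y,E_z)$. A state is admissible if its fluid parts come from primitive variables satisfying the inequalities above. The current density is $\mathbf{J}=(J_x,J_y,J_z)=\sum_{\alpha}r_\alpha\rho_\alpha\Gamma_\alpha\mathbf{u}_\alpha$. Superscripts $n$, $(k)$, $n+1$ on $\mathbf{B},\mathbf{E},\mathbf{J}$ indicate the state $\mathbf{U}^n,\mathbf{U}^{(k)},\mathbf{U}^{n+1}$ they belong to. **Source.** $\mathcal{S}=(\mathcal{S}_i,\mathcal{S}_e,\mathcal{S}_m)$ with $\mathcal{S}_\alpha=\big(0,\ r_\alpha D_\alpha(\mathbf{E}+\mathbf{u}_\alpha\times\mathbf{B}),\ r_\alpha D_\alpha\,\mathbf{u}_\alpha\cdot\mathbf{E}\big)$ and $\mathcal{S}_m=(0,0,0,-J_x,-J_y,-J_z)$. **Mesh.** Uniform rectangular mesh of $[a,b]\times[c,d]$ with cells of size $\Delta x\times\Delta y$, centers $x_i=a+(i+\frac12)\Delta x$, $y_j=c+(j+\frac12)\Delta y$, $0\le i<N_x$, $0\le j<N_y$; vertices $(x_{i+\frac12},y_{j+\frac12})$, $x_{i+\frac12}=\frac{x_i+x_{i+1}}2$,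 $y_{j+\frac12}=\frac{y_j+y_{j+1}}2$. (The species label $i$ and the cell index $i$ are unrelated.) The scheme is imposed in every cell of the grid; values (at each stage) in cells outside the grid (ghost cells) needed by the stencils are prescribed by the boundary conditions and may be arbitrary. **Fluxes** (evaluated from the state $\mathbf{U}$ that is the argument of $\mathcal{L}_{i,j}$). $\mathbf{F}^d=(\mathbf{F}^d_i,\mathbf{F}^d_e,\mathbf{F}^d_m)$, $d\in\{x,y\}$. The fluid fluxes $\mathbf{F}^d_\alpha$ are any numerical fluxes consistent with $\mathbf{f}_\alpha^x=(D_\alpha u_\alpha^x, m_\alpha^xu_\alpha^x+p_\alpha, m_\alpha^yu_\alpha^x,m_\alpha^zu_\alpha^x,m_\alpha^x)$ and $\mathbf{f}_\alpha^y=(D_\alpha u_\alpha^y, m_\alpha^xu_\alpha^y, m_\alpha^yu_\alpha^y+p_\alpha,m_\alpha^zu_\alpha^y,m_\alpha^y)$. The Maxwell fluxes are $$\mathbf{F}_{m,i+\frac12,j}^x=\Big(0,\ -\tfrac12(\tilde E_{z,i+\frac12,j+\frac12}+\tilde E_{z,i+\frac12,j-\frac12}),\ \tilde F^{x,3}_{m,i+\frac12,j},\ 0,\ \tfrac12(\tilde B_{z,i+\frac12,j+\frac12}+\tilde B_{z,i+\frac12,j-\frac12}),\ \tilde F^{x,6}_{m,i+\frac12,j}\Big),$$ $$\mathbf{F}_{m,i,j+\frac12}^y=\Big(\tfrac12(\tilde E_{z,i+\frac12,j+\frac12}+\tilde E_{z,i-\frac12,j+\frac12}),\ 0,\ \tilde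 F^{y,3}_{m,i,j+\frac12},\ -\tfrac12(\tilde B_{z,i+\frac12,j+\frac12}+\tilde B_{z,i-\frac12,j+\frac12}),\ 0,\ \tilde F^{y,6}_{m,i,j+\frac12}\Big).$$ **MinMod** (componentwise): $\mathrm{MinMod}(a,b,c)=\mathrm{sign}(b-a)\min\{|c-b|,|b-a|\}$ if $\mathrm{sign}(b-a)=\mathrm{sign}(c-b)$, and $0$ otherwise. **Vertex values.** At vertex $(i+\frac12,j+\frac12)$, dropping the subscript $m$ on $\mathbf{U}_m$, the diagonal reconstructions are $\hat{\mathbf{U}}^{SW}=\mathbf{U}_{i,j}+\frac12\mathrm{MinMod}(\mathbf{U}_{i-1,j-1},\mathbf{U}_{i,j},\mathbf{U}_{i+1,j+1})$, $\hat{\mathbf{U}}^{SE}=\mathbf{U}_{i+1,j}+\frac12\mathrm{MinMod}(\mathbf{U}_{i+2,j-1},\mathbf{U}_{i+1,j},\mathbf{U}_{i,j+1})$, $\hat{\mathbf{U}}^{NE}=\mathbf{U}_{i+1,j+1}+\frac12\mathrm{MinMod}(\mathbf{U}_{i+2,j+2},\mathbf{U}_{i+1,j+1},\mathbf{U}_{i,j})$, $\hat{\mathbf{U}}^{NW}=\mathbf{U}_{i,j+1}+\frac12\mathrm{MinMod}(\mathbf{U}_{i-1,j+2},\mathbf{U}_{i,j+1},\mathbf{U}_{i+1,j})$, and, with all hatted quantities taken at $(i+\frac12,j+\frac12)$, $$\tilde E_{z,i+\frac12,j+\frac12}=\tfrac14(\hat E_z^{SW}+\hat E_z^{SE}+\hat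 E_z^{NE}+\hat E_z^{NW})+\tfrac14(\hat B_y^{SE}+\hat B_y^{NE}-\hat B_y^{SW}-\hat B_y^{NW})-\tfrac14(\hat B_x^{NW}+\hat B_x^{NE}-\hat B_x^{SW}-\hat B_x^{SE}),$$ $$\tilde B_{z,i+\frac12,j+\frac12}=\tfrac14(\hat B_z^{SW}+\hat B_z^{SE}+\hat B_z^{NE}+\hat B_z^{NW})-\tfrac14(\hat E_x^{NW}+\hat E_x^{NE}-\hat E_x^{SW}-\hat E_x^{SE})+\tfrac14(\hat E_y^{SE}+\hat E_y^{NE}-\hat E_y^{SW}-\hat E_y^{NW}).$$ **One-dimensional components.** With $\mathbf{U}^-_{i+\frac12,j}=\mathbf{U}_{i,j}+\frac12\mathrm{MinMod}(\mathbf{U}_{i-1,j},\mathbf{U}_{i,j},\mathbf{U}_{i+1,j})$ and $\mathbf{U}^+_{i+\frac12,j}=\mathbf{U}_{i+1,j}-\frac12\mathrm{MinMod}(\mathbf{U}_{i,j},\mathbf{U}_{i+1,j},\mathbf{U}_{i+2,j})$ (for $\mathbf{U}_m$), set $\tilde F^{x,3}_m=\frac12(E_y^-+E_y^+)-\frac12(B_z^+-B_z^-)$ and $\tilde F^{x,6}_m=-\frac12(B_y^-+B_y^+)-\frac12(E_z^+-E_z^-)$ at $(i+\frac12,j)$; analogously, with traces $\mathbf{U}^\pm_{i,j+\frac12}$ reconstructed in the $y$-direction, $\tilde F^{y,3}_m=-\frac12(E_x^-+E_x^+)-\frac12(B_z^+-B_z^-)$ and $\tilde F^{y,6}_m=\frac12(B_x^-+B_x^+)-\frac12(E_z^+-E_z^-)$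 at $(i,j+\frac12)$. **Discrete divergence** of a grid vector function $\mathbf{A}=(A_x,A_y,A_z)$ at a vertex: $$(\nabla\cdot\mathbf{A})_{i+\frac12,j+\frac12}=\frac12\left(\frac{A_{x,i+1,j+1}-A_{x,i,j+1}}{\Delta x}+\frac{A_{x,i+1,j}-A_{x,i,j}}{\Delta x}\right)+\frac12\left(\frac{A_{y,i+1,j+1}-A_{y,i+1,j}}{\Delta y}+\frac{A_{y,i,j+1}-A_{y,i,j}}{\Delta y}\right).$$ *)

theory Defs
  imports "HOL-Analysis.Analysis"
begin

text \<open>
  States. The conservative vector in dimension 16 is kept in blocks: a fluid block
  \<open>(D, m, \<E>)\<close> for each species and the Maxwell block \<open>(B, E)\<close>; primitive variables are
  triples \<open>(\<rho>, u, p)\<close>. Components \<open>1, 2, 3\<close> of a \<open>real ^ 3\<close> are the \<open>x, y, z\<close> components.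
  All blocks are real vector spaces, so sums and scalar multiples of states are the
  componentwise ones.
\<close>

datatype species = Ion | Electron

type_synonym prim = "real \<times> (real ^ 3) \<times> real"
type_synonym fluid = "real \<times> (real ^ 3) \<times> real"
type_synonym em = "(real ^ 3) \<times> (real ^ 3)"
type_synonym state = "fluid \<times> fluid \<times> em"

definition fluid_part :: "species \<Rightarrow> state \<Rightarrow> fluid" where
  "fluid_part \<alpha> U = (case \<alpha> of Ion \<Rightarrow> fst U | Electron \<Rightarrow> fst (snd U))"

definition em_part :: "state \<Rightarrow> em" where
  "em_part U = snd (snd U)"

definition B_part :: "state \<Rightarrow> real ^ 3" where
  "B_part U = fst (em_part U)"

definition E_part :: "state \<Rightarrow> real ^ 3" where
  "E_part U = snd (em_part U)"

definition lorentz :: "real ^ 3 \<Rightarrow> real" where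
  "lorentz u = 1 / sqrt (1 - (norm u)\<^sup>2)"

definition enthalpy :: "real \<Rightarrow> real \<Rightarrow> real \<Rightarrow> real" where
  "enthalpy g \<rho> p = 1 + g / (g - 1) * (p / \<rho>)"

definition prim_admissible :: "prim \<Rightarrow> bool" where
  "prim_admissible = (\<lambda>(\<rho>, u, p). 0 < \<rho> \<and> 0 < p \<and> norm u < 1)"

definition conserved :: "real \<Rightarrow> prim \<Rightarrow> fluid" where
  "conserved g = (\<lambda>(\<rho>, u, p).
     (\<rho> * lorentz u,
      (\<rho> * enthalpy g \<rho> p * (lorentz u)\<^sup>2) *\<^sub>R u,
      \<rho> * enthalpy g \<rho> p * (lorentz u)\<^sup>2 - p))"

definition fluid_admissible :: "real \<Rightarrow> fluid \<Rightarrow> bool" where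
  "fluid_admissible g v \<longleftrightarrow> (\<exists>w. prim_admissible w \<and> v = conserved g w)"

definition admissible :: "(species \<Rightarrow> real) \<Rightarrow> state \<Rightarrow> bool" where
  "admissible \<gamma> U \<longleftrightarrow> (\<forall>\<alpha>. fluid_admissible (\<gamma> \<alpha>) (fluid_part \<alpha> U))"

text \<open>
  Primitive variables as functions of the conservative ones. For adiabatic index in
  \<open>(1, 2]\<close> and an admissible state they exist and are unique; see \<open>primitive_conserved\<close> below.
\<close>

definition primitive :: "real \<Rightarrow> fluid \<Rightarrow> prim" where
  "primitive g v = (THE w. prim_admissible w \<and> conserved g w = v)"

definition density :: "real \<Rightarrow> fluid \<Rightarrow> real" where
  "density g v = fst (primitive g v)"

definition velocity :: "real \<Rightarrow> fluid \<Rightarrow> real ^ 3" where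
  "velocity g v = fst (snd (primitive g v))"

definition pressure :: "real \<Rightarrow> fluid \<Rightarrow> real" where
  "pressure g v = snd (snd (primitive g v))"

definition current :: "(species \<Rightarrow> real) \<Rightarrow> (species \<Rightarrow> real) \<Rightarrow> state \<Rightarrow> real ^ 3" where
  "current \<gamma> r U = (\<Sum>\<alpha>\<in>{Ion, Electron}.
     (r \<alpha> * density (\<gamma> \<alpha>) (fluid_part \<alpha> U) * lorentz (velocity (\<gamma> \<alpha>) (fluid_part \<alpha> U)))
       *\<^sub>R velocity (\<gamma> \<alpha>) (fluid_part \<alpha> U))"

definition fluid_source ::
    "(species \<Rightarrow> real) \<Rightarrow> (species \<Rightarrow> real) \<Rightarrow> species \<Rightarrow> state \<Rightarrow> fluid" where
  "fluid_source \<gamma> r \<alpha> U =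
    (let D = fst (fluid_part \<alpha> U); u = velocity (\<gamma> \<alpha>) (fluid_part \<alpha> U) in
      (0, (r \<alpha> * D) *\<^sub>R (E_part U + cross3 u (B_part U)), r \<alpha> * D * (u \<bullet> E_part U)))"

definition source :: "(species \<Rightarrow> real) \<Rightarrow> (species \<Rightarrow> real) \<Rightarrow> state \<Rightarrow> state" where
  "source \<gamma> r U =
    (fluid_source \<gamma> r Ion U, fluid_source \<gamma> r Electron U, (0, - current \<gamma> r U))"

text \<open>
  Grids are indexed by all pairs of integers so that stencils may reach into ghost cells;
  \<open>in_grid\<close> singles out the cells of the mesh. The half-integer positions
  \<open>(i+1/2, j)\<close>, \<open>(i, j+1/2)\<close> and \<open>(i+1/2, j+1/2)\<close> are all addressed by \<open>(i, j)\<close>.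
\<close>

type_synonym 'a grid = "int \<Rightarrow> int \<Rightarrow> 'a"

definition in_grid :: "nat \<Rightarrow> nat \<Rightarrow> int \<Rightarrow> int \<Rightarrow> bool" where
  "in_grid Nx Ny i j \<longleftrightarrow> 0 \<le> i \<and> i < int Nx \<and> 0 \<le> j \<and> j < int Ny"

text \<open>The physical flux of a fluid in direction \<open>k\<close>, with \<open>k = 1\<close> for \<open>x\<close> and \<open>k = 2\<close> for \<open>y\<close>.\<close>

definition fluid_flux :: "real \<Rightarrow> 3 \<Rightarrow> fluid \<Rightarrow> fluid" where
  "fluid_flux g k v = (case v of (D, m, \<E>) \<Rightarrow>
     let u = velocity g v; p = pressure g v in
       (D * u $ k, (u $ k) *\<^sub>R m + p *\<^sub>R axis k 1, m $ k))"

text \<open>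
  \<open>F V i j\<close> is the numerical flux of species \<open>\<alpha>\<close> in direction \<open>k\<close> at the interface
  \<open>(i+1/2, j)\<close> or \<open>(i, j+1/2)\<close> computed from the grid state \<open>V\<close>. Consistency: it equals
  the physical flux whenever all cells of its (finite) stencil carry the same admissible state.
\<close>

definition consistent_flux ::
    "(species \<Rightarrow> real) \<Rightarrow> species \<Rightarrow> 3 \<Rightarrow> (state grid \<Rightarrow> fluid grid) \<Rightarrow> bool" where
  "consistent_flux \<gamma> \<alpha> k F \<longleftrightarrow>
    (\<exists>S :: (int \<times> int) set. finite S \<and>
      (\<forall>V i j W. admissible \<gamma> W \<and> (\<forall>(s, t)\<in>S. V (i + s) (j + t) = W)
         \<longrightarrow> F V i j = fluid_flux (\<gamma> \<alpha>) k (fluid_part \<alpha> W)))"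

definition minmod :: "real \<Rightarrow> real \<Rightarrow> real \<Rightarrow> real" where
  "minmod a b c =
    (if sgn (b - a) = sgn (c - b) then sgn (b - a) * min \<bar>c - b\<bar> \<bar>b - a\<bar> else 0)"

definition MinMod :: "em \<Rightarrow> em \<Rightarrow> em \<Rightarrow> em" where
  "MinMod a b c =
    (\<chi> k. minmod (fst a $ k) (fst b $ k) (fst c $ k),
     \<chi> k. minmod (snd a $ k) (snd b $ k) (snd c $ k))"

definition rec_SW :: "em grid \<Rightarrow> em grid" where
  "rec_SW M i j =
    M i j + (1/2) *\<^sub>R MinMod (M (i - 1) (j - 1)) (M i j) (M (i + 1) (j + 1))"

definition rec_SE :: "em grid \<Rightarrow> em grid" where
  "rec_SE M i j =
    M (i + 1) j + (1/2) *\<^sub>R MinMod (M (i + 2) (j - 1)) (M (i + 1) j) (M i (j + 1))"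

definition rec_NE :: "em grid \<Rightarrow> em grid" where
  "rec_NE M i j =
    M (i + 1) (j + 1) + (1/2) *\<^sub>R MinMod (M (i + 2) (j + 2)) (M (i + 1) (j + 1)) (M i j)"

definition rec_NW :: "em grid \<Rightarrow> em grid" where
  "rec_NW M i j =
    M i (j + 1) + (1/2) *\<^sub>R MinMod (M (i - 1) (j + 2)) (M i (j + 1)) (M (i + 1) j)"

abbreviation Bx :: "em \<Rightarrow> real" where "Bx W \<equiv> fst W $ 1"
abbreviation By :: "em \<Rightarrow> real" where "By W \<equiv> fst W $ 2"
abbreviation Bz :: "em \<Rightarrow> real" where "Bz W \<equiv> fst W $ 3"
abbreviation Ex :: "em \<Rightarrow> real" where "Ex W \<equiv> snd W $ 1"
abbreviation Ey :: "em \<Rightarrow> real" where "Ey W \<equiv> snd W $ 2"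
abbreviation Ez :: "em \<Rightarrow> real" where "Ez W \<equiv> snd W $ 3"

definition vertex_Ez :: "em grid \<Rightarrow> real grid" where
  "vertex_Ez M i j =
    (let SW = rec_SW M i j; SE = rec_SE M i j; NE = rec_NE M i j; NW = rec_NW M i j in
      1/4 * (Ez SW + Ez SE + Ez NE + Ez NW)
      + 1/4 * (By SE + By NE - By SW - By NW)
      - 1/4 * (Bx NW + Bx NE - Bx SW - Bx SE))"

definition vertex_Bz :: "em grid \<Rightarrow> real grid" where
  "vertex_Bz M i j =
    (let SW = rec_SW M i j; SE = rec_SE M i j; NE = rec_NE M i j; NW = rec_NW M i j in
      1/4 * (Bz SW + Bz SE + Bz NE + Bz NW)
      - 1/4 * (Ex NW + Ex NE - Ex SW - Ex SE)
      + 1/4 * (Ey SE + Ey NE - Ey SW - Ey NW))"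

definition trace_x_minus :: "em grid \<Rightarrow> em grid" where
  "trace_x_minus M i j = M i j + (1/2) *\<^sub>R MinMod (M (i - 1) j) (M i j) (M (i + 1) j)"

definition trace_x_plus :: "em grid \<Rightarrow> em grid" where
  "trace_x_plus M i j =
    M (i + 1) j - (1/2) *\<^sub>R MinMod (M i j) (M (i + 1) j) (M (i + 2) j)"

definition trace_y_minus :: "em grid \<Rightarrow> em grid" where
  "trace_y_minus M i j = M i j + (1/2) *\<^sub>R MinMod (M i (j - 1)) (M i j) (M i (j + 1))"

definition trace_y_plus :: "em grid \<Rightarrow> em grid" where
  "trace_y_plus M i j =
    M i (j + 1) - (1/2) *\<^sub>R MinMod (M i j) (M i (j + 1)) (M i (j + 2))"

definition maxwell_flux_x :: "em grid \<Rightarrow> em grid" where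
  "maxwell_flux_x M i j =
    (let L = trace_x_minus M i j; R = trace_x_plus M i j in
      (vector [0,
               - (1/2) * (vertex_Ez M i j + vertex_Ez M i (j - 1)),
               1/2 * (Ey L + Ey R) - 1/2 * (Bz R - Bz L)],
       vector [0,
               1/2 * (vertex_Bz M i j + vertex_Bz M i (j - 1)),
               - (1/2) * (By L + By R) - 1/2 * (Ez R - Ez L)]))"

definition maxwell_flux_y :: "em grid \<Rightarrow> em grid" where
  "maxwell_flux_y M i j =
    (let L = trace_y_minus M i j; R = trace_y_plus M i j in
      (vector [1/2 * (vertex_Ez M i j + vertex_Ez M (i - 1) j),
               0,
               - (1/2) * (Ex L + Ex R) - 1/2 * (Bz R - Bz L)],
       vector [- (1/2) * (vertex_Bz M i j + vertex_Bz M (i - 1) j),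
               0,
               1/2 * (Bx L + Bx R) - 1/2 * (Ez R - Ez L)]))"

definition flux_x :: "(species \<Rightarrow> state grid \<Rightarrow> fluid grid) \<Rightarrow> state grid \<Rightarrow> state grid" where
  "flux_x Fx V i j =
    (Fx Ion V i j, Fx Electron V i j, maxwell_flux_x (\<lambda>k l. em_part (V k l)) i j)"

definition flux_y :: "(species \<Rightarrow> state grid \<Rightarrow> fluid grid) \<Rightarrow> state grid \<Rightarrow> state grid" where
  "flux_y Fy V i j =
    (Fy Ion V i j, Fy Electron V i j, maxwell_flux_y (\<lambda>k l. em_part (V k l)) i j)"

definition space_op ::
    "real \<Rightarrow> real \<Rightarrow> (species \<Rightarrow> state grid \<Rightarrow> fluid grid) \<Rightarrow>
     (species \<Rightarrow> state grid \<Rightarrow> fluid grid) \<Rightarrow> state grid \<Rightarrow> state grid" where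
  "space_op dx dy Fx Fy V i j =
    - (1 / dx) *\<^sub>R (flux_x Fx V i j - flux_x Fx V (i - 1) j)
    - (1 / dy) *\<^sub>R (flux_y Fy V i j - flux_y Fy V i (j - 1))"

definition discrete_div :: "real \<Rightarrow> real \<Rightarrow> (real ^ 3) grid \<Rightarrow> real grid" where
  "discrete_div dx dy A i j =
    1/2 * ((A (i + 1) (j + 1) $ 1 - A i (j + 1) $ 1) / dx + (A (i + 1) j $ 1 - A i j $ 1) / dx)
    + 1/2 * ((A (i + 1) (j + 1) $ 2 - A (i + 1) j $ 2) / dy + (A i (j + 1) $ 2 - A i j $ 2) / dy)"

lemma pressure_scalar_unique:
  fixes a b W1 W2 p1 p2 D E k :: real
  assumes "0 \<le> a" "a < 1" "0 \<le> b" "b < 1" and D: "0 < D" and k: "0 < k" "k \<le> 1/2"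
    and W: "0 < W1" "0 < W2" and Wp: "W1 = E + p1" "W2 = E + p2" and Wab: "W1 * a = W2 * b"
    and p1: "p1 = k * (W1 * (1 - a\<^sup>2) - D * sqrt (1 - a\<^sup>2))"
    and p2: "p2 = k * (W2 * (1 - b\<^sup>2) - D * sqrt (1 - b\<^sup>2))"
  shows "a \<ge> b"
proof (rule ccontr)
  assume "\<not> a \<ge> b"
  then have ab: "a < b" by simp
  have a0: "0 < a"
  proof (rule ccontr)
    assume "\<not> 0 < a"
    then have "a = 0" using assms(1) by linarith
    then show False using Wab W(2) ab by simp
  qed
  define d where "d = sqrt (1 - a\<^sup>2) - sqrt (1 - b\<^sup>2)"
  have "sqrt (1 - b\<^sup>2) \<le> sqrt (1 - a\<^sup>2)"
    using ab a0 by (simp add: power_mono)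
  then have d: "0 \<le> k * D * d" using D k(1) by (simp add: d_def)
  have sq: "W1 * a\<^sup>2 - W2 * b\<^sup>2 = W2 * b * (a - b)"
  proof -
    have "W1 * a\<^sup>2 = (W1 * a) * a" by (simp add: power2_eq_square)
    then show ?thesis unfolding Wab by (simp add: power2_eq_square algebra_simps)
  qed
  have "W1 - W2 = p1 - p2" using Wp by linarith
  also have "p1 - p2 = k * (W1 - W2) - k * (W1 * a\<^sup>2 - W2 * b\<^sup>2) - k * D * d"
    by (subst p1, subst p2) (simp add: algebra_simps d_def)
  finally have "(1 - k) * (W1 - W2) = k * (W2 * b * (b - a)) - k * D * d"
    unfolding sq by (simp add: algebra_simps)
  then have "(1 - k) * (W1 - W2) \<le> k * (W2 * b * (b - a))"
    using d by linarith
  then have le: "a * ((1 - k) * (W1 - W2)) \<le> a * (k * (W2 * b * (b - a)))"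
    using a0 by simp
  have "a * (W1 - W2) = W2 * (b - a)"
    using Wab by (simp add: algebra_simps)
  then have eq1: "a * ((1 - k) * (W1 - W2)) = (1 - k) * (W2 * (b - a))"
    by (simp only: mult.left_commute[of a])
  have "a * (k * (W2 * b * (b - a))) = (k * (a * b)) * (W2 * (b - a))"
    by (simp add: algebra_simps)
  with le eq1 have "(1 - k) * (W2 * (b - a)) \<le> (k * (a * b)) * (W2 * (b - a))"
    by simp
  moreover have "0 < W2 * (b - a)" using ab W(2) by simp
  ultimately have "1 - k \<le> k * (a * b)"
    by (rule mult_right_le_imp_le)
  moreover have "a * b < 1 * 1" using a0 ab assms(2,4) by (intro mult_strict_mono) auto
  then have "k * (a * b) < k" using k(1) by simp
  ultimately show False using k(2) by linarith
qed

lemma conserved_relations: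
  assumes g: "1 < g" and w: "prim_admissible (\<rho>, u, p)"
    and c: "conserved g (\<rho>, u, p) = (D, m, E)"
  shows "0 < E + p" "m = (E + p) *\<^sub>R u" "0 < D" "\<rho> = D * sqrt (1 - (norm u)\<^sup>2)"
    "p = (g - 1) / g * ((E + p) * (1 - (norm u)\<^sup>2) - D * sqrt (1 - (norm u)\<^sup>2))"
proof -
  have adm: "0 < \<rho>" "0 < p" "norm u < 1" using w by (auto simp: prim_admissible_def)
  have n: "0 < 1 - (norm u)\<^sup>2" using adm(3) by (simp add: abs_square_less_1)
  have h: "\<rho> * enthalpy g \<rho> p = \<rho> + g / (g - 1) * p"
    using adm by (simp add: enthalpy_def distrib_left)
  have hpos: "0 < \<rho> * enthalpy g \<rho> p" unfolding h using adm g by (simp add: add_pos_pos)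
  have L: "(lorentz u)\<^sup>2 = 1 / (1 - (norm u)\<^sup>2)"
    using n by (simp add: lorentz_def power_divide)
  have Ep: "E + p = \<rho> * enthalpy g \<rho> p * (lorentz u)\<^sup>2"
    using c by (auto simp: conserved_def)
  then show "0 < E + p" unfolding L using hpos n by simp
  show "m = (E + p) *\<^sub>R u" unfolding Ep using c by (auto simp: conserved_def)
  have D: "D = \<rho> * lorentz u" using c by (auto simp: conserved_def)
  then show "0 < D" using n adm by (simp add: lorentz_def)
  show rho: "\<rho> = D * sqrt (1 - (norm u)\<^sup>2)" unfolding D using n by (simp add: lorentz_def)
  have "(E + p) * (1 - (norm u)\<^sup>2) = \<rho> + g / (g - 1) * p"
    unfolding Ep L h[symmetric] using n by simp
  then have "(E + p) * (1 - (norm u)\<^sup>2) - D * sqrt (1 - (norm u)\<^sup>2) = g / (g - 1) * p"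
    using rho by simp
  then show "p = (g - 1) / g * ((E + p) * (1 - (norm u)\<^sup>2) - D * sqrt (1 - (norm u)\<^sup>2))"
    using g by simp
qed

lemma conserved_inj:
  assumes g: "1 < g" "g \<le> 2" and w: "prim_admissible w1" "prim_admissible w2"
    and eq: "conserved g w1 = conserved g w2"
  shows "w1 = w2"
proof -
  obtain \<rho>1 u1 p1 where w1: "w1 = (\<rho>1, u1, p1)" by (cases w1)
  obtain \<rho>2 u2 p2 where w2: "w2 = (\<rho>2, u2, p2)" by (cases w2)
  obtain D m E where v: "conserved g w1 = (D, m, E)" by (cases "conserved g w1")
  note r1 = conserved_relations[OF g(1) w(1)[unfolded w1] v[unfolded w1]]
  note r2 = conserved_relations[OF g(1) w(2)[unfolded w2] v[unfolded eq w2]]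
  define k where "k = (g - 1) / g"
  have k: "0 < k" "k \<le> 1/2" using g by (auto simp: k_def field_simps)
  have u: "norm u1 < 1" "norm u2 < 1" using w by (auto simp: w1 w2 prim_admissible_def)
  have m: "(E + p1) * norm u1 = (E + p2) * norm u2"
    using arg_cong[OF trans[OF r1(2)[symmetric] r2(2)], of norm] r1(1) r2(1) by simp
  have "norm u1 \<ge> norm u2"
    by (rule pressure_scalar_unique[OF _ u(1) _ u(2) r1(3) k r1(1) r2(1) refl refl m])
      (use r1(5) r2(5) in \<open>simp_all add: k_def\<close>)
  moreover have "norm u2 \<ge> norm u1"
    by (rule pressure_scalar_unique[OF _ u(2) _ u(1) r1(3) k r2(1) r1(1) refl refl m[symmetric]])
      (use r1(5) r2(5) in \<open>simp_all add: k_def\<close>)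
  ultimately have n: "norm u1 = norm u2" by simp
  have "p1 - p2 = k * (1 - (norm u2)\<^sup>2) * (p1 - p2)"
    using r1(5) r2(5) unfolding n k_def[symmetric] by (simp add: algebra_simps)
  moreover have "k * (1 - (norm u2)\<^sup>2) \<le> k * 1"
    using k by (intro mult_left_mono) auto
  then have "k * (1 - (norm u2)\<^sup>2) \<noteq> 1" using k by linarith
  ultimately have p: "p1 = p2" by (metis eq_iff_diff_eq_0 mult_cancel_right1)
  have "u1 = u2" using r1(1,2) r2(2) p by auto
  moreover have "\<rho>1 = \<rho>2" using r1(4) r2(4) n by simp
  ultimately show ?thesis using p by (simp add: w1 w2)
qed

lemma primitive_conserved:
  assumes "1 < g" "g \<le> 2" "prim_admissible w"
  shows "primitive g (conserved g w) = w"
  unfolding primitive_def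
proof (rule the_equality)
  show "prim_admissible w \<and> conserved g w = conserved g w" using assms(3) by simp
next
  fix w' assume "prim_admissible w' \<and> conserved g w' = conserved g w"
  then show "w' = w" using conserved_inj[OF assms(1,2) _ assms(3)] by blast
qed

end

theory Submission
  imports Defs
begin

text \<open>
  In the first two components, the Maxwell part of the spatial operator is a discrete curl: both
  fluxes average the same vertex potential (\<open>vertex_Ez\<close> for the magnetic field,
  \<open>- vertex_Bz\<close> for the electric field) over the two end points of an interface. Thus
  the first component averages the potential in \<open>x\<close> and differences it in
  \<open>y\<close>, and the second one does the opposite, with the other sign. The vertex
  divergence differences the first component in \<open>x\<close> and averages it in
  \<open>y\<close>, and again the opposite for the second one. Either way the potential is
  averaged and differenced once in each direction, and since these one-dimensional operators
  commute, the two contributions cancel, just as \<open>div curl = 0\<close> follows from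
  commuting partial derivatives (\<open>discrete_div_vertex_curl\<close>). The cancellation is an
  identity in the potential: it rests only on the fact that all interfaces ending at a vertex use
  the same number there, whatever cell values it was reconstructed from.

  Consequently each forward Euler stage changes the discrete divergence through the source alone,
  by \<open>0\<close> for the magnetic field and by \<open>- dt\<close> times the divergence of the current for the
  electric field (\<open>divergence_euler_step\<close>). The scheme averages the initial state with the
  result of two such stages, which halves the sum of the two source contributions.
\<close>

text \<open>
  The discrete counterpart of \<open>curl (0, 0, P) = (\<partial>\<^sub>y P, - \<partial>\<^sub>x P, 0)\<close> for a potential \<open>P\<close> at
  vertices, with values in cells and the sign of Faraday's law, \<open>\<partial>\<^sub>t B = - curl E\<close>. The cell
  \<open>(i, j)\<close> has the corners \<open>(i - 1, j - 1)\<close>, \<open>(i, j - 1)\<close>, \<open>(i - 1, j)\<close>, \<open>(i, j)\<close> in the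
  numbering of vertices by their south-west cell.
\<close>

definition vertex_curl :: "real \<Rightarrow> real \<Rightarrow> real grid \<Rightarrow> (real ^ 3) grid" where
  "vertex_curl dx dy P i j =
    vector [- (P i j + P (i - 1) j - P i (j - 1) - P (i - 1) (j - 1)) / (2 * dy),
            (P i j + P i (j - 1) - P (i - 1) j - P (i - 1) (j - 1)) / (2 * dx),
            0]"

lemma discrete_div_vertex_curl: "discrete_div dx dy (vertex_curl dx dy P) i j = 0"
  by (simp add: discrete_div_def vertex_curl_def vector_3 diff_divide_distrib add_divide_distrib)

text \<open>
  Locality of the divergence: it transfers equations that hold only inside the grid, where the
  scheme is imposed, and only in the first two components, where the space operator is a curl.
\<close>

lemma discrete_div_cong:
  assumes "\<And>k l. k \<in> {i, i + 1} \<Longrightarrow> l \<in> {j, j + 1} \<Longrightarrow>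
      A k l $ 1 = A' k l $ 1 \<and> A k l $ 2 = A' k l $ 2"
  shows "discrete_div dx dy A i j = discrete_div dx dy A' i j"
  by (simp add: discrete_div_def assms)

lemma discrete_div_add:
  "discrete_div dx dy (\<lambda>k l. A k l + A' k l) i j
    = discrete_div dx dy A i j + discrete_div dx dy A' i j"
  by (simp add: discrete_div_def diff_divide_distrib add_divide_distrib algebra_simps)

lemma discrete_div_scaleR:
  "discrete_div dx dy (\<lambda>k l. s *\<^sub>R A k l) i j = s * discrete_div dx dy A i j"
  by (simp add: discrete_div_def diff_divide_distrib add_divide_distrib algebra_simps)

lemma B_part_linear [simp]:
  "B_part (U + V) = B_part U + B_part V" "B_part (s *\<^sub>R U) = s *\<^sub>R B_part U"
  by (simp_all add: B_part_def em_part_def)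

lemma E_part_linear [simp]:
  "E_part (U + V) = E_part U + E_part V" "E_part (s *\<^sub>R U) = s *\<^sub>R E_part U"
  by (simp_all add: E_part_def em_part_def)

lemma B_part_source [simp]: "B_part (source \<gamma> r U) = 0"
  by (simp add: B_part_def em_part_def source_def)

lemma E_part_source [simp]: "E_part (source \<gamma> r U) = - current \<gamma> r U"
  by (simp add: E_part_def em_part_def source_def)

text \<open>
  Both fluxes of a field read the same vertex potential, so the two components of the space
  operator fit together into one curl. The third component is a difference of one-dimensional
  fluxes and of a different form.
\<close>

lemma B_part_space_op:
  fixes V :: "state grid" and dx dy :: real
  defines "C \<equiv> vertex_curl dx dy (vertex_Ez (\<lambda>k l. em_part (V k l)))"
  shows "B_part (space_op dx dy Fx Fy V i j) $ 1 = C i j $ 1"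
    and "B_part (space_op dx dy Fx Fy V i j) $ 2 = C i j $ 2"
  unfolding C_def
  by (simp_all add: B_part_def em_part_def space_op_def flux_x_def flux_y_def maxwell_flux_x_def
      maxwell_flux_y_def vertex_curl_def Let_def vector_3 diff_divide_distrib add_divide_distrib)

text \<open>The sign of the potential is that of Ampere's law, \<open>\<partial>\<^sub>t E = curl B - J\<close>.\<close>

lemma E_part_space_op:
  fixes V :: "state grid" and dx dy :: real
  defines "C \<equiv> vertex_curl dx dy (\<lambda>k l. - vertex_Bz (\<lambda>k l. em_part (V k l)) k l)"
  shows "E_part (space_op dx dy Fx Fy V i j) $ 1 = C i j $ 1"
    and "E_part (space_op dx dy Fx Fy V i j) $ 2 = C i j $ 2"
  unfolding C_def
  by (simp_all add: E_part_def em_part_def space_op_def flux_x_def flux_y_def maxwell_flux_x_def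
      maxwell_flux_y_def vertex_curl_def Let_def vector_3 diff_divide_distrib add_divide_distrib)

lemma discrete_div_space_op:
  shows "discrete_div dx dy (\<lambda>k l. B_part (space_op dx dy Fx Fy V k l)) i j = 0"
    and "discrete_div dx dy (\<lambda>k l. E_part (space_op dx dy Fx Fy V k l)) i j = 0"
  by (subst discrete_div_cong[OF conjI[OF B_part_space_op]]
        discrete_div_cong[OF conjI[OF E_part_space_op]],
      rule discrete_div_vertex_curl)+

text \<open>
  The divergence is linear, and it annihilates the space operator, so only the source is left.
  The step is assumed just around the vertex \<open>(i, j)\<close> because the scheme says nothing about the
  ghost cells.
\<close>

lemma divergence_euler_step:
  assumes step: "\<And>k l. k \<in> {i, i + 1} \<Longrightarrow> l \<in> {j, j + 1} \<Longrightarrow>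
      V' k l = V k l + dt *\<^sub>R space_op dx dy Fx Fy V k l + dt *\<^sub>R source \<gamma> r (V k l)"
  shows "discrete_div dx dy (\<lambda>k l. B_part (V' k l)) i j
      = discrete_div dx dy (\<lambda>k l. B_part (V k l)) i j"
    and "discrete_div dx dy (\<lambda>k l. E_part (V' k l)) i j
      = discrete_div dx dy (\<lambda>k l. E_part (V k l)) i j
        - dt * discrete_div dx dy (\<lambda>k l. current \<gamma> r (V k l)) i j"
proof -
  let ?L = "space_op dx dy Fx Fy V"
  have "discrete_div dx dy (\<lambda>k l. B_part (V' k l)) i j
      = discrete_div dx dy (\<lambda>k l. B_part (V k l) + dt *\<^sub>R B_part (?L k l)) i j"
    by (rule discrete_div_cong) (simp add: step)
  then show "discrete_div dx dy (\<lambda>k l. B_part (V' k l)) i j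
      = discrete_div dx dy (\<lambda>k l. B_part (V k l)) i j"
    by (simp add: discrete_div_add discrete_div_scaleR discrete_div_space_op)
  have "discrete_div dx dy (\<lambda>k l. E_part (V' k l)) i j
      = discrete_div dx dy (\<lambda>k l. E_part (V k l) + dt *\<^sub>R E_part (?L k l)
          + (- dt) *\<^sub>R current \<gamma> r (V k l)) i j"
    by (rule discrete_div_cong) (simp add: step)
  then show "discrete_div dx dy (\<lambda>k l. E_part (V' k l)) i j
      = discrete_div dx dy (\<lambda>k l. E_part (V k l)) i j
        - dt * discrete_div dx dy (\<lambda>k l. current \<gamma> r (V k l)) i j"
    unfolding discrete_div_add discrete_div_scaleR discrete_div_space_op by simp
qed

theorem proposition4p1:
  fixes \<gamma> r :: "species \<Rightarrow> real"
    and a b c d dx dy dt :: real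
    and Nx Ny :: nat
    and Fx Fy :: "species \<Rightarrow> state grid \<Rightarrow> fluid grid"
    and Uold U0 U1 U2 Unew :: "state grid"
  assumes gamma: "\<And>\<alpha>. 1 < \<gamma> \<alpha> \<and> \<gamma> \<alpha> \<le> 2"
    and domain: "a < b" "c < d"
    and mesh: "0 < Nx" "0 < Ny" "dx = (b - a) / real Nx" "dy = (d - c) / real Ny"
    and time_step: "0 < dt"
    and consistent: "\<And>\<alpha>. consistent_flux \<gamma> \<alpha> 1 (Fx \<alpha>)" "\<And>\<alpha>. consistent_flux \<gamma> \<alpha> 2 (Fy \<alpha>)"
    and admissible_n: "\<And>i j. in_grid Nx Ny i j \<Longrightarrow> admissible \<gamma> (Uold i j)"
    and admissible_1: "\<And>i j. in_grid Nx Ny i j \<Longrightarrow> admissible \<gamma> (U1 i j)"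
    and stage_0: "\<And>i j. in_grid Nx Ny i j \<Longrightarrow> U0 i j = Uold i j"
    and stage_1: "\<And>i j. in_grid Nx Ny i j \<Longrightarrow>
          U1 i j = U0 i j + dt *\<^sub>R space_op dx dy Fx Fy U0 i j + dt *\<^sub>R source \<gamma> r (U0 i j)"
    and stage_2: "\<And>i j. in_grid Nx Ny i j \<Longrightarrow>
          U2 i j = U1 i j + dt *\<^sub>R space_op dx dy Fx Fy U1 i j + dt *\<^sub>R source \<gamma> r (U1 i j)"
    and update: "\<And>i j. in_grid Nx Ny i j \<Longrightarrow> Unew i j = (1/2) *\<^sub>R (U0 i j + U2 i j)"
  shows "\<forall>i j. 0 \<le> i \<and> i \<le> int Nx - 2 \<and> 0 \<le> j \<and> j \<le> int Ny - 2 \<longrightarrow>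
      discrete_div dx dy (\<lambda>k l. B_part (Unew k l)) i j
        = discrete_div dx dy (\<lambda>k l. B_part (Uold k l)) i j
    \<and> discrete_div dx dy (\<lambda>k l. E_part (Unew k l)) i j
        = discrete_div dx dy (\<lambda>k l. E_part (Uold k l)) i j
          - dt / 2 * (discrete_div dx dy (\<lambda>k l. current \<gamma> r (Uold k l)) i j
                    + discrete_div dx dy (\<lambda>k l. current \<gamma> r (U1 k l)) i j)"
proof (intro allI impI)
  fix i j
  assume ij: "0 \<le> i \<and> i \<le> int Nx - 2 \<and> 0 \<le> j \<and> j \<le> int Ny - 2"
  let ?div = "\<lambda>A. discrete_div dx dy A i j"
  have cell: "in_grid Nx Ny k l" if "k \<in> {i, i + 1}" "l \<in> {j, j + 1}" for k l
    using ij that by (auto simp: in_grid_def)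
  have step_1: "U1 k l = U0 k l + dt *\<^sub>R space_op dx dy Fx Fy U0 k l + dt *\<^sub>R source \<gamma> r (U0 k l)"
    if "k \<in> {i, i + 1}" "l \<in> {j, j + 1}" for k l
    using that by (intro stage_1 cell)
  have step_2: "U2 k l = U1 k l + dt *\<^sub>R space_op dx dy Fx Fy U1 k l + dt *\<^sub>R source \<gamma> r (U1 k l)"
    if "k \<in> {i, i + 1}" "l \<in> {j, j + 1}" for k l
    using that by (intro stage_2 cell)
  note euler_1 = divergence_euler_step[of i j, OF step_1]
  note euler_2 = divergence_euler_step[of i j, OF step_2]
  have start: "?div (\<lambda>k l. f (U0 k l)) = ?div (\<lambda>k l. f (Uold k l))" for f :: "state \<Rightarrow> real ^ 3"
    by (rule discrete_div_cong) (simp add: stage_0[OF cell])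
  have average: "?div (\<lambda>k l. f (Unew k l))
      = 1/2 * (?div (\<lambda>k l. f (U0 k l)) + ?div (\<lambda>k l. f (U2 k l)))"
    if "f \<in> {B_part, E_part}" for f :: "state \<Rightarrow> real ^ 3"
  proof -
    have "?div (\<lambda>k l. f (Unew k l)) = ?div (\<lambda>k l. (1/2) *\<^sub>R (f (U0 k l) + f (U2 k l)))"
      using that by (intro discrete_div_cong) (auto simp: update[OF cell])
    then show ?thesis by (simp add: discrete_div_add discrete_div_scaleR)
  qed
  have "?div (\<lambda>k l. B_part (Unew k l)) = ?div (\<lambda>k l. B_part (Uold k l))"
    using average[of B_part] euler_1(1) euler_2(1) start[of B_part] by simp
  moreover have "?div (\<lambda>k l. E_part (Unew k l)) = ?div (\<lambda>k l. E_part (Uold k l))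
      - dt / 2 * (?div (\<lambda>k l. current \<gamma> r (Uold k l)) + ?div (\<lambda>k l. current \<gamma> r (U1 k l)))"
    using average[of E_part] euler_1(2) euler_2(2) start[of E_part] start[of "current \<gamma> r"]
    by (simp add: algebra_simps)
  ultimately show "?div (\<lambda>k l. B_part (Unew k l)) = ?div (\<lambda>k l. B_part (Uold k l))
    \<and> ?div (\<lambda>k l. E_part (Unew k l)) = ?div (\<lambda>k l. E_part (Uold k l))
      - dt / 2 * (?div (\<lambda>k l. current \<gamma> r (Uold k l)) + ?div (\<lambda>k l. current \<gamma> r (U1 k l)))"
    by blast
qed

end
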